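(* Let $K$ be a field, let $G$ be an abelian group and let $\theta=(\{X_t\}_{t\in G},\{h_t\}_{t\in G})$ be a partial action of $G$ on a set $X$. Let $\mathcal{F}_0(X)$ be the algebra of all finitely supported functions $X\to K$, and let $\mathcal{F}_0(X)\star G$ be the partial skew group ring of the partial action of $G$ on $\mathcal{F}_0(X)$ induced by $\theta$. Then $\mathcal{F}_0(X)\star G$ is simple if and only if $\theta$ is minimal and free.
   Context: $G$ is written additively with identity $0$. A partial action of $G$ on a set $X$ is a pair $\theta=(\{X_t\}_{t\in G},\{h_t\}_{t\in G})$ where $X_t\subseteq X$, each $h_t:X_{-t}\to X_t$ is a bijection, $X_0=X$, $h_0=\mathrm{id}_X$, $h_t(X_{-t}\cap X_s)=X_t\cap X_{t+s}$, and $h_t(h_s(x))=h_{t+s}(x)$ for all $x\in X_{-s}\cap X_{-s-t}$. A subset $V\subseteq X$ is $G$-invariant if $h_t(V\cap X_{-t})\subseteq V$ for all $t\in G$. $\theta$ is minimal if the only $G$-invariant subsets of $X$ are $\emptyset$ and $X$. $\theta$ is free if, for all $t\in G$ and $x\in X_{-t}$, $h_t(x)=x$ implies $t=0$. $\mathcal{F}_0(X)$ has pointwise operations. The induced partial action $\alpha=(\{D_t\},\{\alpha_t\})$ of $G$ on $\mathcal{F}_0(X)$ is given by the ideals $D_t=\mathcal{F}_0(X_t)=\{f\in\mathcal{F}_0(X): f(x)=0\ \forall x\notin X_t\}$ and the isomorphisms $\alpha_t:D_{-t}\to D_t$, $\alpha_t(f)=f\circ h_{-t}$ on $X_t$ and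 $0$ off $X_t$. The partial skew group ring $\mathcal{F}_0(X)\star G$ is the set of finite formal sums $\sum_{t\in G}a_t\delta_t$ with $a_t\in D_t$, with the obvious addition and with multiplication determined by $(a_t\delta_t)(b_s\delta_s)=\alpha_t(\alpha_{-t}(a_t)b_s)\delta_{t+s}$; it is an associative ring. A ring is simple if its only two-sided ideals are $\{0\}$ and the whole ring. *)

theory Defs
  imports Main "HOL-Library.Function_Algebras"
begin

text \<open>
  The family \<open>D t\<close> is $X_t$ and \<open>h t\<close> is $h_t$. Each \<open>h t\<close> is a total function of the
  ambient type; only its values on \<open>D (- t)\<close> matter.
\<close>

locale partial_action =
  fixes X :: "'x set" and D :: "'g::ab_group_add \<Rightarrow> 'x set" and h :: "'g \<Rightarrow> 'x \<Rightarrow> 'x"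
  assumes D_subset: "D t \<subseteq> X"
    and h_bij: "bij_betw (h t) (D (- t)) (D t)"
    and D_zero: "D 0 = X"
    and h_zero: "x \<in> X \<Longrightarrow> h 0 x = x"
    and h_image: "h t ` (D (- t) \<inter> D s) = D t \<inter> D (t + s)"
    and h_comp: "x \<in> D (- s) \<inter> D (- s - t) \<Longrightarrow> h t (h s x) = h (t + s) x"

definition invariant_subset :: "'x set \<Rightarrow> ('g::ab_group_add \<Rightarrow> 'x set) \<Rightarrow> ('g \<Rightarrow> 'x \<Rightarrow> 'x) \<Rightarrow> 'x set \<Rightarrow> bool"
  where "invariant_subset X D h V \<longleftrightarrow> V \<subseteq> X \<and> (\<forall>t. h t ` (V \<inter> D (- t)) \<subseteq> V)"

definition minimal_action :: "'x set \<Rightarrow> ('g::ab_group_add \<Rightarrow> 'x set) \<Rightarrow> ('g \<Rightarrow> 'x \<Rightarrow> 'x) \<Rightarrow> bool"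
  where "minimal_action X D h \<longleftrightarrow> (\<forall>V. invariant_subset X D h V \<longrightarrow> V = {} \<or> V = X)"

definition free_action :: "('g::ab_group_add \<Rightarrow> 'x set) \<Rightarrow> ('g \<Rightarrow> 'x \<Rightarrow> 'x) \<Rightarrow> bool"
  where "free_action D h \<longleftrightarrow> (\<forall>t. \<forall>x\<in>D (- t). h t x = x \<longrightarrow> t = 0)"

text \<open>
  A function on $X$ is represented by its extension by 0 to the ambient type. Sums and products
  of functions are the pointwise ones of \<^theory>\<open>HOL-Library.Function_Algebras\<close>.
\<close>

definition F0 :: "'x set \<Rightarrow> ('x \<Rightarrow> 'k::field) set"
  where "F0 X = {f. finite {x. f x \<noteq> 0} \<and> (\<forall>x. x \<notin> X \<longrightarrow> f x = 0)}"

definition induced_iso ::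
    "('g::ab_group_add \<Rightarrow> 'x set) \<Rightarrow> ('g \<Rightarrow> 'x \<Rightarrow> 'x) \<Rightarrow> 'g \<Rightarrow> ('x \<Rightarrow> 'k::field) \<Rightarrow> 'x \<Rightarrow> 'k"
  where "induced_iso D h t f = (\<lambda>x. if x \<in> D t then f (h (- t) x) else 0)"

text \<open>
  A finite formal sum $\sum_t a_t \delta_t$ is represented by its coefficient family
  \<open>\<lambda>t. a t\<close>, so that addition of formal sums is pointwise addition.
\<close>

definition skew_ring :: "('g::ab_group_add \<Rightarrow> 'x set) \<Rightarrow> ('g \<Rightarrow> 'x \<Rightarrow> 'k::field) set"
  where "skew_ring D = {a. finite {t. a t \<noteq> 0} \<and> (\<forall>t. a t \<in> F0 (D t))}"

definition delta :: "'g \<Rightarrow> ('x \<Rightarrow> 'k::field) \<Rightarrow> 'g \<Rightarrow> 'x \<Rightarrow> 'k"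
  where "delta t f = (\<lambda>r. if r = t then f else 0)"

definition skew_mult ::
    "('g::ab_group_add \<Rightarrow> 'x set) \<Rightarrow> ('g \<Rightarrow> 'x \<Rightarrow> 'x)
      \<Rightarrow> ('g \<Rightarrow> 'x \<Rightarrow> 'k::field) \<Rightarrow> ('g \<Rightarrow> 'x \<Rightarrow> 'k) \<Rightarrow> 'g \<Rightarrow> 'x \<Rightarrow> 'k"
  where "skew_mult D h a b =
    (\<Sum>t | a t \<noteq> 0. \<Sum>s | b s \<noteq> 0.
      delta (t + s) (induced_iso D h t (induced_iso D h (- t) (a t) * b s)))"

text \<open>
  The ring below need not have an identity, so ideals in the sense of \<open>HOL-Algebra\<close>, which
  presuppose a unital ring, do not apply. Here a ring is a carrier \<open>R\<close> closed under the
  addition of an ambient abelian group, together with a multiplication \<open>m\<close>.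
\<close>

definition two_sided_ideal :: "'a::ab_group_add set \<Rightarrow> ('a \<Rightarrow> 'a \<Rightarrow> 'a) \<Rightarrow> 'a set \<Rightarrow> bool"
  where "two_sided_ideal R m I \<longleftrightarrow>
    I \<subseteq> R \<and> 0 \<in> I \<and> (\<forall>a\<in>I. \<forall>b\<in>I. a + b \<in> I) \<and> (\<forall>a\<in>I. - a \<in> I) \<and>
    (\<forall>r\<in>R. \<forall>a\<in>I. m r a \<in> I \<and> m a r \<in> I)"

definition simple_ring :: "'a::ab_group_add set \<Rightarrow> ('a \<Rightarrow> 'a \<Rightarrow> 'a) \<Rightarrow> bool"
  where "simple_ring R m \<longleftrightarrow> (\<forall>I. two_sided_ideal R m I \<longrightarrow> I = {0} \<or> I = R)"

lemma skew_mult_delta: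
  "skew_mult D h (delta t a) (delta s b) =
    delta (t + s) (induced_iso D h t (induced_iso D h (- t) a * b))"
proof -
  have supp: "{r. delta u c r \<noteq> 0} = (if c = 0 then {} else {u})" for u :: 'a and c :: "'b \<Rightarrow> 'c"
    by (auto simp: delta_def)
  have zero: "delta u (0 :: 'b \<Rightarrow> 'c) = 0" for u :: 'a
    by (auto simp: delta_def fun_eq_iff)
  have iso0: "induced_iso D h u (0 :: 'b \<Rightarrow> 'c) = 0" for u
    by (auto simp: induced_iso_def fun_eq_iff)
  have at: "delta u c u = c" for u :: 'a and c :: "'b \<Rightarrow> 'c"
    by (simp add: delta_def)
  show ?thesis
    by (cases "a = 0"; cases "b = 0") (simp_all add: skew_mult_def supp zero iso0 at)
qed

end

theory Submission
  imports Defs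
begin

text \<open>
  Write \<open>elem x t c\<close> for \<open>c 1\<^sub>x \<delta>\<^sub>t\<close>, where \<open>x \<in> X\<^sub>t\<close>. These elements span the skew
  group ring, and \<open>elem x t c * elem y s d\<close> is \<open>elem x (t + s) (c d)\<close> if \<open>h\<^bsub>-t\<^esub> x = y\<close> and \<open>0\<close> otherwise,
  so they multiply like matrix units.

  An invariant \<open>V\<close> gives the ideal of the elements supported in \<open>V\<close>, so simplicity forces
  minimality. The ring also acts on functions \<open>v\<close> on \<open>X\<close> by
  \<open>(a v) x = \<Sum>\<^sub>t a\<^sub>t(x) v(h\<^bsub>-t\<^esub> x)\<close>; if \<open>h\<^sub>t x = x\<close> with \<open>t \<noteq> 0\<close> then
  \<open>elem x 0 1 - elem x t 1\<close> is a nonzero element of the kernel of this action, which is a proper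
  ideal, so simplicity forces freeness.

  Conversely, let \<open>a\<close> be in an ideal with \<open>a\<^sub>t(x) \<noteq> 0\<close> and let \<open>y = h\<^bsub>-t\<^esub> x\<close>. By freeness
  \<open>elem x 0 1 * a * elem y 0 1 = elem x t (a\<^sub>t(x))\<close>, which yields \<open>elem x 0 1\<close> in the ideal. The points \<open>x\<close>
  with this property form an invariant set, so by minimality the ideal contains everything.
\<close>

section \<open>Additive structure of the skew group ring\<close>

lemma sum_fun_apply: "(\<Sum>i\<in>A. f i) x = (\<Sum>i\<in>A. f i x)"
  by (induction A rule: infinite_finite_induct) auto

lemma skew_ring_iff:
  "a \<in> skew_ring D \<longleftrightarrow> finite {t. a t \<noteq> 0} \<and> (\<forall>t. finite {x. a t x \<noteq> 0})
    \<and> (\<forall>t x. a t x \<noteq> 0 \<longrightarrow> x \<in> D t)"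
  by (auto simp: skew_ring_def F0_def)

lemma skew_ringI:
  assumes "finite {t. a t \<noteq> 0}" "\<And>t. finite {x. a t x \<noteq> 0}"
    "\<And>t x. a t x \<noteq> 0 \<Longrightarrow> x \<in> D t"
  shows "a \<in> skew_ring D"
  using assms by (simp add: skew_ring_iff)

lemma zero_in_skew_ring: "0 \<in> skew_ring D"
  by (simp add: skew_ring_iff)

lemma uminus_in_skew_ring: "a \<in> skew_ring D \<Longrightarrow> - a \<in> skew_ring D"
  by (simp add: skew_ring_iff)

lemma add_in_skew_ring:
  assumes "a \<in> skew_ring D" "b \<in> skew_ring D"
  shows "a + b \<in> skew_ring D"
proof (rule skew_ringI)
  show "finite {t. (a + b) t \<noteq> 0}"
    by (rule finite_subset[of _ "{t. a t \<noteq> 0} \<union> {t. b t \<noteq> 0}"])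
      (use assms in \<open>auto simp: skew_ring_iff\<close>)
  show "finite {x. (a + b) t x \<noteq> 0}" for t
    by (rule finite_subset[of _ "{x. a t x \<noteq> 0} \<union> {x. b t x \<noteq> 0}"])
      (use assms in \<open>auto simp: skew_ring_iff\<close>)
  show "x \<in> D t" if "(a + b) t x \<noteq> 0" for t x
  proof -
    have "a t x \<noteq> 0 \<or> b t x \<noteq> 0" using that by auto
    then show ?thesis using assms by (auto simp: skew_ring_iff)
  qed
qed

lemma two_sided_ideal_sum:
  assumes "two_sided_ideal R m I" "\<And>i. i \<in> A \<Longrightarrow> f i \<in> I"
  shows "sum f A \<in> I"
  using assms(2)
proof (induction A rule: infinite_finite_induct)
  case (insert i A)
  then show ?case using assms(1) by (auto simp: two_sided_ideal_def)
qed (use assms(1) in \<open>auto simp: two_sided_ideal_def\<close>)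

section \<open>Spanning elements, and the action on functions\<close>

definition elem :: "'x \<Rightarrow> 'g \<Rightarrow> 'k \<Rightarrow> 'g \<Rightarrow> 'x \<Rightarrow> 'k::field"
  where "elem x t c = delta t (\<lambda>y. if y = x then c else 0)"

lemma elem_apply: "elem x t c s y = (if s = t \<and> y = x then c else 0)"
  by (auto simp: elem_def delta_def)

lemma elem_in_skew_ring:
  assumes "x \<in> D t"
  shows "elem x t c \<in> skew_ring D"
proof (rule skew_ringI)
  show "finite {s. elem x t c s \<noteq> 0}"
    by (rule finite_subset[of _ "{t}"]) (auto simp: elem_def delta_def)
  show "finite {y. elem x t c s y \<noteq> 0}" for s
    by (rule finite_subset[of _ "{x}"]) (auto simp: elem_apply)
qed (use assms in \<open>auto simp: elem_apply split: if_splits\<close>)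

text \<open>All supports are finite, so evaluating at one degree and one point isolates a single
  term. This reduces membership of a whole element in an ideal to membership of its
  \<open>elem\<close> terms.\<close>

lemma skew_ring_eq_sum_elem:
  assumes "a \<in> skew_ring D"
  shows "a = (\<Sum>t | a t \<noteq> 0. \<Sum>x | a t x \<noteq> 0. elem x t (a t x))"
proof (intro ext)
  fix s y
  have fin: "finite {t. a t \<noteq> 0}" "finite {x. a t x \<noteq> 0}" for t
    using assms by (auto simp: skew_ring_iff)
  have "(\<Sum>t | a t \<noteq> 0. \<Sum>x | a t x \<noteq> 0. elem x t (a t x)) s y =
      (\<Sum>t | a t \<noteq> 0. \<Sum>x | a t x \<noteq> 0. elem x t (a t x) s y)"
    by (simp add: sum_fun_apply)
  also have "\<dots> = (\<Sum>t | a t \<noteq> 0. if s = t then a s y else 0)"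
  proof (rule sum.cong[OF refl])
    fix t
    have "(\<Sum>x | a t x \<noteq> 0. elem x t (a t x) s y) =
        (\<Sum>x | a t x \<noteq> 0. if y = x then if s = t then a s y else 0 else 0)"
      by (rule sum.cong) (auto simp: elem_apply)
    also have "\<dots> = (if s = t then a s y else 0)"
      using fin by (subst sum.delta') auto
    finally show "(\<Sum>x | a t x \<noteq> 0. elem x t (a t x) s y) = (if s = t then a s y else 0)" .
  qed
  also have "\<dots> = a s y"
    using fin by (subst sum.delta') auto
  finally show "a s y = (\<Sum>t | a t \<noteq> 0. \<Sum>x | a t x \<noteq> 0. elem x t (a t x)) s y" by simp
qed

text \<open>For \<open>a\<close> in the skew ring, \<open>a t x\<close> vanishes off
  \<open>D t\<close>, so the values of \<open>h (- t)\<close> outside its domain do not enter. No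
  support condition is put on \<open>v\<close>, so constant functions are allowed.\<close>

definition act ::
    "('g::ab_group_add \<Rightarrow> 'x \<Rightarrow> 'x) \<Rightarrow> ('g \<Rightarrow> 'x \<Rightarrow> 'k::field) \<Rightarrow> ('x \<Rightarrow> 'k) \<Rightarrow> 'x \<Rightarrow> 'k"
  where "act h a v x = (\<Sum>t | a t \<noteq> 0. a t x * v (h (- t) x))"

text \<open>Allows sums belonging to elements with different supports to be compared over one common
  index set.\<close>

lemma act_superset:
  assumes "finite S" "{t. a t \<noteq> 0} \<subseteq> S"
  shows "act h a v x = (\<Sum>t\<in>S. a t x * v (h (- t) x))"
  unfolding act_def by (rule sum.mono_neutral_left) (use assms in auto)

lemma act_zero: "act h 0 v = 0"
  by (simp add: act_def fun_eq_iff)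

lemma act_zero_right: "act h a 0 = 0"
  by (simp add: act_def fun_eq_iff)

lemma act_uminus: "act h (- a) v = - act h a v"
  by (simp add: act_def fun_eq_iff sum_negf)

lemma act_add:
  assumes "finite {t. a t \<noteq> 0}" "finite {t. b t \<noteq> 0}"
  shows "act h (a + b) v = act h a v + act h b v"
proof
  fix x
  let ?S = "{t. a t \<noteq> 0} \<union> {t. b t \<noteq> 0}"
  have "act h (a + b) v x = (\<Sum>t\<in>?S. (a + b) t x * v (h (- t) x))"
    by (rule act_superset) (use assms in auto)
  also have "\<dots> = (\<Sum>t\<in>?S. a t x * v (h (- t) x)) + (\<Sum>t\<in>?S. b t x * v (h (- t) x))"
    by (simp add: sum.distrib ring_distribs)
  also have "(\<Sum>t\<in>?S. a t x * v (h (- t) x)) = act h a v x"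
    by (rule act_superset[symmetric]) (use assms in auto)
  also have "(\<Sum>t\<in>?S. b t x * v (h (- t) x)) = act h b v x"
    by (rule act_superset[symmetric]) (use assms in auto)
  finally show "act h (a + b) v x = (act h a v + act h b v) x"
    by (simp add: plus_fun_def)
qed

lemma act_elem: "act h (elem x t c) v y = (if y = x then c * v (h (- t) x) else 0)"
  proof -
  have "act h (elem x t c) v y = (\<Sum>s\<in>{t}. elem x t c s y * v (h (- s) y))"
    by (rule act_superset) (auto simp: elem_def delta_def)
  then show ?thesis by (simp add: elem_apply)
qed

section \<open>Inverses, domains and composites in a partial action\<close>

context partial_action
begin

lemma in_X: "x \<in> D t \<Longrightarrow> x \<in> X"
  using D_subset by blast

lemma h_minus_in: "x \<in> D t \<Longrightarrow> h (- t) x \<in> D (- t)"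
  using h_bij[of "- t"] by (auto dest: bij_betwE)

lemma h_in: "x \<in> D (- t) \<Longrightarrow> h t x \<in> D t"
  using h_minus_in[of x "- t"] by simp

lemma h_cancel: "x \<in> D t \<Longrightarrow> h t (h (- t) x) = x"
  using h_comp[of x "- t" t] D_subset[of t] by (auto simp: D_zero h_zero)

lemma h_minus_cancel: "x \<in> D (- t) \<Longrightarrow> h (- t) (h t x) = x"
  using h_cancel[of x "- t"] by simp

lemma h_in_D_add: "x \<in> D (- t) \<Longrightarrow> x \<in> D s \<Longrightarrow> h t x \<in> D (t + s)"
  using h_image[of t s] by auto

text \<open>The image axiom for \<open>h (- t)\<close> gives one direction and for its inverse
  \<open>h t\<close> the other. It places a product of terms of degrees \<open>t\<close> and
  \<open>s - t\<close> in \<open>D s\<close>.\<close>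

lemma h_minus_in_D_iff: "x \<in> D t \<Longrightarrow> h (- t) x \<in> D (s - t) \<longleftrightarrow> x \<in> D s"
  using h_in_D_add[of x "- t" s] h_in_D_add[OF h_minus_in, of x t "s - t"] h_cancel[of x t] by auto

lemma h_minus_comp:
  "x \<in> D t \<Longrightarrow> x \<in> D s \<Longrightarrow> h (- (s - t)) (h (- t) x) = h (- s) x"
  using h_comp[of x "- t" "- (s - t)"] by simp

text \<open>Going out along \<open>- t\<close> and back along \<open>s\<close> shows that
  \<open>h (s - t)\<close> fixes \<open>x\<close>, so freeness applies to
  \<open>s - t\<close>.\<close>

lemma free_actionD:
  assumes "free_action D h" "x \<in> D t" "x \<in> D s" "h (- t) x = h (- s) x"
  shows "t = s"
proof -
  \<comment> \<open>The common image lies in both \<open>D (- t)\<close> and \<open>D (- s)\<close>,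
    so \<open>h t\<close> carries it back into \<open>D (t - s)\<close>.\<close>
  have x: "x \<in> D (- (s - t))"
    using h_in_D_add[OF h_minus_in[OF assms(2)], of "- s"] h_minus_in[OF assms(3)]
      h_cancel[OF assms(2)] assms(4) by simp
  have "h (s - t) x = h s (h (- t) x)"
    using h_comp[of x "- t" s] x assms(2) by simp
  also have "\<dots> = x" using assms h_cancel by simp
  finally have "s - t = 0" using assms(1) x unfolding free_action_def by blast
  then show ?thesis by simp
qed

section \<open>The product as a twisted convolution\<close>

lemma induced_iso_mult_apply:
  assumes "\<And>y. y \<notin> D t \<Longrightarrow> f y = 0"
  shows "induced_iso D h t (induced_iso D h (- t) f * g) x = f x * g (h (- t) x)"
  \<comment> \<open>On \<open>D t\<close> the two transports of \<open>f\<close> cancel; off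
    \<open>D t\<close> both sides are zero by the assumption on \<open>f\<close>.\<close>
  using assms h_minus_in[of x t] h_cancel[of x t] by (auto simp: induced_iso_def)

text \<open>For fixed \<open>t\<close> only \<open>s = r - t\<close> reaches degree
  \<open>r\<close>; if that \<open>s\<close> is outside the support of \<open>b\<close>, both sides
  get zero.\<close>

lemma skew_mult_apply:
  assumes a: "a \<in> skew_ring D" and b: "finite {s. b s \<noteq> 0}"
  shows "skew_mult D h a b r x = (\<Sum>t | a t \<noteq> 0. a t x * b (r - t) (h (- t) x))"
proof -
  have "skew_mult D h a b r x = (\<Sum>t | a t \<noteq> 0. \<Sum>s | b s \<noteq> 0.
      delta (t + s) (induced_iso D h t (induced_iso D h (- t) (a t) * b s)) r x)"
    by (simp add: skew_mult_def sum_fun_apply)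
  also have "\<dots> = (\<Sum>t | a t \<noteq> 0. a t x * b (r - t) (h (- t) x))"
  proof (rule sum.cong[OF refl])
    fix t
    have "y \<notin> D t \<Longrightarrow> a t y = 0" for y
      using a by (auto simp: skew_ring_iff)
    then have "(\<Sum>s | b s \<noteq> 0.
        delta (t + s) (induced_iso D h t (induced_iso D h (- t) (a t) * b s)) r x) =
      (\<Sum>s | b s \<noteq> 0. if r - t = s then a t x * b s (h (- t) x) else 0)"
      by (intro sum.cong) (auto simp: delta_def induced_iso_mult_apply)
    also have "\<dots> = a t x * b (r - t) (h (- t) x)"
      using b by (subst sum.delta') auto
    finally show "(\<Sum>s | b s \<noteq> 0.
        delta (t + s) (induced_iso D h t (induced_iso D h (- t) (a t) * b s)) r x) =
      a t x * b (r - t) (h (- t) x)" .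
  qed
  finally show ?thesis .
qed

lemma skew_mult_nonzeroE:
  assumes "a \<in> skew_ring D" "b \<in> skew_ring D" "skew_mult D h a b r x \<noteq> 0"
  obtains t where "a t x \<noteq> 0" "b (r - t) (h (- t) x) \<noteq> 0"
proof -
  have "(\<Sum>t | a t \<noteq> 0. a t x * b (r - t) (h (- t) x)) \<noteq> 0"
    using assms skew_mult_apply[of a b r x] by (simp add: skew_ring_iff)
  then obtain t where "a t x * b (r - t) (h (- t) x) \<noteq> 0"
    by (rule sum.not_neutral_contains_not_neutral)
  then show ?thesis using that[of t] by simp
qed

lemma skew_mult_support:
  assumes "a \<in> skew_ring D" "b \<in> skew_ring D"
  shows "{r. skew_mult D h a b r \<noteq> 0} \<subseteq>
    (\<lambda>(t, s). t + s) ` ({t. a t \<noteq> 0} \<times> {s. b s \<noteq> 0})"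
proof
  fix r assume "r \<in> {r. skew_mult D h a b r \<noteq> 0}"
  then obtain x where "skew_mult D h a b r x \<noteq> 0" by (auto simp: fun_eq_iff)
  then obtain t where t: "a t x \<noteq> 0" "b (r - t) (h (- t) x) \<noteq> 0"
    using skew_mult_nonzeroE assms by blast
  then have "a t \<noteq> 0" "b (r - t) \<noteq> 0" by auto
  then show "r \<in> (\<lambda>(t, s). t + s) ` ({t. a t \<noteq> 0} \<times> {s. b s \<noteq> 0})"
    by (intro image_eqI[of _ _ "(t, r - t)"]) auto
qed

lemma skew_mult_in_skew_ring:
  assumes a: "a \<in> skew_ring D" and b: "b \<in> skew_ring D"
  shows "skew_mult D h a b \<in> skew_ring D"
proof (rule skew_ringI)
  show "finite {r. skew_mult D h a b r \<noteq> 0}"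
    using a b by (intro finite_subset[OF skew_mult_support[OF a b]] finite_imageI
        finite_cartesian_product) (simp_all add: skew_ring_iff)
  show "finite {x. skew_mult D h a b r x \<noteq> 0}" for r
  proof (rule finite_subset)
    \<comment> \<open>Every term of the convolution carries a factor \<open>a t x\<close>, so the
      left factor alone bounds the points of the support.\<close>
    show "{x. skew_mult D h a b r x \<noteq> 0} \<subseteq> (\<Union>t\<in>{t. a t \<noteq> 0}. {x. a t x \<noteq> 0})"
    proof
      fix x assume "x \<in> {x. skew_mult D h a b r x \<noteq> 0}"
      then obtain t where "a t x \<noteq> 0" by (auto elim: skew_mult_nonzeroE[OF a b])
      moreover from this have "a t \<noteq> 0" by auto
      ultimately show "x \<in> (\<Union>t\<in>{t. a t \<noteq> 0}. {x. a t x \<noteq> 0})" by blast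
    qed
  qed (use a in \<open>auto simp: skew_ring_iff\<close>)
  show "x \<in> D r" if nz: "skew_mult D h a b r x \<noteq> 0" for r x
  proof -
    obtain t where "a t x \<noteq> 0" "b (r - t) (h (- t) x) \<noteq> 0"
      using skew_mult_nonzeroE[OF a b nz] .
    then have "x \<in> D t" "h (- t) x \<in> D (r - t)" using a b by (auto simp: skew_ring_iff)
    then show ?thesis using h_minus_in_D_iff by blast
  qed
qed

lemma skew_mult_elem_left:
  assumes "x \<in> D t" "b \<in> skew_ring D"
  shows "skew_mult D h (elem x t c) b r y = (if y = x then c * b (r - t) (h (- t) x) else 0)"
proof -
  have "elem x t c \<in> skew_ring D" using assms(1) by (rule elem_in_skew_ring)
  then have "skew_mult D h (elem x t c) b r y =
      (\<Sum>s | elem x t c s \<noteq> 0. elem x t c s y * b (r - s) (h (- s) y))"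
    using assms(2) by (intro skew_mult_apply) (simp_all add: skew_ring_iff)
  also have "\<dots> = (\<Sum>s\<in>{t}. elem x t c s y * b (r - s) (h (- s) y))"
    by (rule sum.mono_neutral_left) (auto simp: elem_def delta_def fun_eq_iff)
  finally show ?thesis by (simp add: elem_apply)
qed

lemma skew_mult_elem:
  assumes "x \<in> D t" "h (- t) x \<in> D s"
  shows "skew_mult D h (elem x t c) (elem (h (- t) x) s d) = elem x (t + s) (c * d)"
  by (intro ext, subst skew_mult_elem_left)
    (use assms in \<open>auto simp: elem_in_skew_ring elem_apply algebra_simps\<close>)

text \<open>After the substitution \<open>r = t + s\<close> the terms on both sides agree because
  \<open>h (- (t + s)) x\<close> factors through \<open>h (- t) x\<close> wherever the coefficients
  are nonzero.\<close>

lemma act_skew_mult: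
  assumes a: "a \<in> skew_ring D" and b: "b \<in> skew_ring D"
  shows "act h (skew_mult D h a b) v = act h a (act h b v)"
proof
  fix x
  let ?A = "{t. a t \<noteq> 0}" and ?B = "{s. b s \<noteq> 0}"
  \<comment> \<open>An index set that contains the support of the product whatever cancellation
    occurs, and contains \<open>t + s\<close> for all degrees of the factors.\<close>
  let ?S = "(\<lambda>(t, s). t + s) ` (?A \<times> ?B)"
  have fin: "finite ?A" "finite ?B" using a b by (auto simp: skew_ring_iff)
  have "act h (skew_mult D h a b) v x = (\<Sum>r\<in>?S. skew_mult D h a b r x * v (h (- r) x))"
    by (rule act_superset[OF _ skew_mult_support[OF a b]]) (use fin in auto)
  also have "\<dots> = (\<Sum>r\<in>?S. \<Sum>t\<in>?A. a t x * b (r - t) (h (- t) x) * v (h (- r) x))"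
    using a fin by (simp add: skew_mult_apply sum_distrib_right)
  also have "\<dots> = (\<Sum>t\<in>?A. \<Sum>r\<in>?S. a t x * b (r - t) (h (- t) x) * v (h (- r) x))"
    by (rule sum.swap)
  also have "\<dots> = (\<Sum>t\<in>?A. a t x * act h b v (h (- t) x))"
  proof (rule sum.cong[OF refl])
    fix t assume t: "t \<in> ?A"
    have "(\<Sum>r\<in>?S. a t x * b (r - t) (h (- t) x) * v (h (- r) x)) =
        (\<Sum>r\<in>(\<lambda>s. t + s) ` ?B. a t x * b (r - t) (h (- t) x) * v (h (- r) x))"
    proof (rule sum.mono_neutral_right)
      show "\<forall>r\<in>?S - (\<lambda>s. t + s) ` ?B. a t x * b (r - t) (h (- t) x) * v (h (- r) x) = 0"
      proof
        fix r assume r: "r \<in> ?S - (\<lambda>s. t + s) ` ?B"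
        have "b (r - t) = 0"
        proof (rule ccontr)
          assume "b (r - t) \<noteq> 0"
          then have "r \<in> (\<lambda>s. t + s) ` ?B" by (intro image_eqI[of _ _ "r - t"]) auto
          with r show False by blast
        qed
        then show "a t x * b (r - t) (h (- t) x) * v (h (- r) x) = 0" by simp
      qed
    qed (use t fin in auto)
    also have "\<dots> = (\<Sum>s\<in>?B. a t x * b s (h (- t) x) * v (h (- (t + s)) x))"
      by (subst sum.reindex) auto
    also have "\<dots> = (\<Sum>s\<in>?B. a t x * (b s (h (- t) x) * v (h (- s) (h (- t) x))))"
    proof (rule sum.cong[OF refl])
      fix s
      show "a t x * b s (h (- t) x) * v (h (- (t + s)) x) =
          a t x * (b s (h (- t) x) * v (h (- s) (h (- t) x)))"
      \<comment> \<open>The composition law can fail outside the domains, but there one of the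
        coefficients is zero.\<close>
      proof (cases "a t x = 0 \<or> b s (h (- t) x) = 0")
        case False
        then have "x \<in> D t" "h (- t) x \<in> D s" using a b by (auto simp: skew_ring_iff)
        then have "h (- s) (h (- t) x) = h (- (t + s)) x"
          using h_minus_in_D_iff[of x t "t + s"] h_minus_comp[of x t "t + s"] by simp
        then show ?thesis by simp
      qed auto
    qed
    finally show "(\<Sum>r\<in>?S. a t x * b (r - t) (h (- t) x) * v (h (- r) x)) =
        a t x * act h b v (h (- t) x)"
      by (simp add: act_def sum_distrib_left)
  qed
  finally show "act h (skew_mult D h a b) v x = act h a (act h b v) x"
    by (simp add: act_def)
qed

section \<open>Two ideals: elements supported in an invariant set, and the kernel of the
  action\<close>

lemma two_sided_ideal_invariant:
  assumes "invariant_subset X D h V"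
  shows "two_sided_ideal (skew_ring D :: ('g \<Rightarrow> 'x \<Rightarrow> 'k::field) set) (skew_mult D h)
    {a \<in> skew_ring D. \<forall>t x. a t x \<noteq> 0 \<longrightarrow> x \<in> V}"
proof -
  let ?I = "{a :: 'g \<Rightarrow> 'x \<Rightarrow> 'k. a \<in> skew_ring D \<and> (\<forall>t x. a t x \<noteq> 0 \<longrightarrow> x \<in> V)}"
  have "a + b \<in> ?I" if "a \<in> ?I" "b \<in> ?I" for a b
  proof -
    have "x \<in> V" if "(a + b) t x \<noteq> 0" for t x
      using that \<open>a \<in> ?I\<close> \<open>b \<in> ?I\<close> by (cases "a t x = 0") auto
    then show ?thesis using that add_in_skew_ring by blast
  qed
  moreover have "skew_mult D h r a \<in> ?I" if r: "r \<in> skew_ring D" and a: "a \<in> ?I" for r a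
  proof -
    have aR: "a \<in> skew_ring D" using a by simp
    have "x \<in> V" if nz: "skew_mult D h r a s x \<noteq> 0" for s x
    proof -
      obtain t where "r t x \<noteq> 0" "a (s - t) (h (- t) x) \<noteq> 0"
        using skew_mult_nonzeroE[OF r aR nz] .
      then have "x \<in> D t" "h (- t) x \<in> V" using a r by (auto simp: skew_ring_iff)
      \<comment> \<open>Left multiplication moves support points: \<open>h (- t) x\<close> is in
        \<open>V\<close>, and invariance under \<open>h t\<close> returns to
        \<open>x\<close>.\<close>
      then have "h (- t) x \<in> V \<inter> D (- t)" using h_minus_in by blast
      then have "h t (h (- t) x) \<in> V" using assms by (auto simp: invariant_subset_def)
      then show ?thesis using h_cancel \<open>x \<in> D t\<close> by simp
    qed
    then show ?thesis using skew_mult_in_skew_ring[OF r aR] by blast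
  qed
  moreover have "skew_mult D h a r \<in> ?I" if r: "r \<in> skew_ring D" and a: "a \<in> ?I" for r a
  proof -
    have aR: "a \<in> skew_ring D" using a by simp
    have "x \<in> V" if "skew_mult D h a r s x \<noteq> 0" for s x
      using skew_mult_nonzeroE[OF aR r that] a by blast
    then show ?thesis using skew_mult_in_skew_ring[OF aR r] by blast
  qed
  moreover have "?I \<subseteq> skew_ring D" "0 \<in> ?I" "\<And>a. a \<in> ?I \<Longrightarrow> - a \<in> ?I"
    by (auto simp: zero_in_skew_ring uminus_in_skew_ring)
  ultimately show ?thesis
    unfolding two_sided_ideal_def by (intro conjI ballI)
qed

text \<open>By \<open>act_skew_mult\<close>, a left multiple of \<open>a\<close> applies the other
  factor to 0, while a right multiple applies \<open>a\<close> to a new function; the latter is why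
  all \<open>v\<close> are quantified.\<close>

lemma two_sided_ideal_act_kernel:
  "two_sided_ideal (skew_ring D :: ('g \<Rightarrow> 'x \<Rightarrow> 'k::field) set) (skew_mult D h)
    {a \<in> skew_ring D. \<forall>v. act h a v = 0}"
proof -
  have "act h (a + b) v = act h a v + act h b v"
    if "a \<in> skew_ring D" "b \<in> skew_ring D" for a b :: "'g \<Rightarrow> 'x \<Rightarrow> 'k" and v
    using that by (intro act_add) (auto simp: skew_ring_iff)
  then show ?thesis
    by (simp add: two_sided_ideal_def zero_in_skew_ring uminus_in_skew_ring add_in_skew_ring
        skew_mult_in_skew_ring act_skew_mult act_zero act_zero_right act_uminus)
qed

section \<open>Simplicity forces minimality and freeness\<close>

lemma simple_imp_minimal:
  assumes "simple_ring (skew_ring D :: ('g \<Rightarrow> 'x \<Rightarrow> 'k::field) set) (skew_mult D h)"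
  shows "minimal_action X D h"
  unfolding minimal_action_def
proof (intro allI impI)
  fix V assume V: "invariant_subset X D h V"
  let ?I = "{a :: 'g \<Rightarrow> 'x \<Rightarrow> 'k. a \<in> skew_ring D \<and> (\<forall>t x. a t x \<noteq> 0 \<longrightarrow> x \<in> V)}"
  have sub: "V \<subseteq> X" using V by (simp add: invariant_subset_def)
  \<comment> \<open>These elements recover \<open>V\<close> from the ideal, so the ideals
    \<open>{0}\<close> and \<open>skew_ring D\<close> correspond to \<open>V = {}\<close> and
    \<open>V = X\<close>.\<close>
  have elem: "elem x 0 1 \<in> ?I \<longleftrightarrow> x \<in> V" if "x \<in> X" for x
    using that by (auto simp: elem_apply elem_in_skew_ring D_zero split: if_splits)
  have nz: "elem x 0 (1 :: 'k) \<noteq> (0 :: 'g \<Rightarrow> 'x \<Rightarrow> 'k)" for x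
    by (metis elem_apply zero_fun_apply zero_neq_one)
  from two_sided_ideal_invariant[OF V] assms consider "?I = {0}" | "?I = skew_ring D"
    unfolding simple_ring_def by blast
  then show "V = {} \<or> V = X"
  proof cases
    case 1
    then show ?thesis using elem nz sub by blast
  next
    case 2
    have "x \<in> V" if "x \<in> X" for x
      using elem[OF that] 2 elem_in_skew_ring[of x D 0 "1 :: 'k"] that D_zero by simp
    then show ?thesis using sub by blast
  qed
qed

lemma simple_imp_free:
  assumes "simple_ring (skew_ring D :: ('g \<Rightarrow> 'x \<Rightarrow> 'k::field) set) (skew_mult D h)"
  shows "free_action D h"
  unfolding free_action_def
proof (intro allI ballI impI, rule ccontr)
  fix t x assume x: "x \<in> D (- t)" "h t x = x" and t: "t \<noteq> 0"
  let ?I = "{a :: 'g \<Rightarrow> 'x \<Rightarrow> 'k. a \<in> skew_ring D \<and> (\<forall>v. act h a v = 0)}"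
  let ?e = "elem x 0 1 :: 'g \<Rightarrow> 'x \<Rightarrow> 'k" and ?d = "elem x t (- 1) :: 'g \<Rightarrow> 'x \<Rightarrow> 'k"
  have xX: "x \<in> X" using x(1) by (rule in_X)
  \<comment> \<open>A fixed point also lies in the range \<open>D t\<close>, so \<open>?d\<close> is
    an element of the ring.\<close>
  have xt: "x \<in> D t" using h_in[OF x(1)] x(2) by simp
  have ht: "h (- t) x = x" using h_minus_cancel[OF x(1)] x(2) by simp
  have R: "?e \<in> skew_ring D" "?d \<in> skew_ring D"
    using xX xt by (auto simp: elem_in_skew_ring D_zero)
  have "act h (?e + ?d) v = 0" for v
    by (subst act_add) (use R xX ht in \<open>auto simp: skew_ring_iff act_elem h_zero fun_eq_iff\<close>)
  then have "?e + ?d \<in> ?I" using R by (simp add: add_in_skew_ring)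
  moreover have "(?e + ?d) 0 x \<noteq> 0" using t by (simp add: elem_apply)
  then have "?e + ?d \<noteq> 0" by (metis zero_fun_apply)
  ultimately have "?I \<noteq> {0}" by blast
  then have "?I = skew_ring D"
    using assms two_sided_ideal_act_kernel unfolding simple_ring_def by blast
  then have "?e \<in> ?I" using R by blast
  \<comment> \<open>The constant function 1 shows that the kernel is proper: \<open>?e\<close> sends
    it to the indicator of \<open>x\<close>.\<close>
  then have "act h ?e (\<lambda>_. 1) x = 0" by simp
  then show False by (simp add: act_elem)
qed

section \<open>Minimality and freeness force simplicity\<close>

lemma minimal_free_imp_simple:
  assumes "minimal_action X D h" and free: "free_action D h"
  shows "simple_ring (skew_ring D :: ('g \<Rightarrow> 'x \<Rightarrow> 'k::field) set) (skew_mult D h)"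
  unfolding simple_ring_def
proof (intro allI impI)
  fix I :: "('g \<Rightarrow> 'x \<Rightarrow> 'k) set"
  assume I: "two_sided_ideal (skew_ring D) (skew_mult D h) I"
  have sub: "I \<subseteq> skew_ring D" and zero: "0 \<in> I"
    and left: "\<And>r a. r \<in> skew_ring D \<Longrightarrow> a \<in> I \<Longrightarrow> skew_mult D h r a \<in> I"
    and right: "\<And>r a. r \<in> skew_ring D \<Longrightarrow> a \<in> I \<Longrightarrow> skew_mult D h a r \<in> I"
    using I by (auto simp: two_sided_ideal_def)
  let ?V = "{x \<in> X. elem x 0 1 \<in> I}"
  have "invariant_subset X D h ?V"
    unfolding invariant_subset_def
  proof (intro conjI allI image_subsetI)
    fix t x assume "x \<in> ?V \<inter> D (- t)"
    then have x: "x \<in> D (- t)" "x \<in> X" "elem x 0 1 \<in> I" by auto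
    have y: "h t x \<in> D t" "h (- t) (h t x) = x" using x h_in h_minus_cancel by auto
    \<comment> \<open>Conjugation moves the idempotent at \<open>x\<close> to \<open>h t x\<close>:
      multiply by degree \<open>t\<close> on the left, then by degree \<open>- t\<close> on the
      right.\<close>
    have "skew_mult D h (elem (h t x) t 1) (elem x 0 1) = elem (h t x) t (1 :: 'k)"
      using skew_mult_elem[of "h t x" t 0 1 1] x y by (simp add: D_zero)
    then have "elem (h t x) t (1 :: 'k) \<in> I"
      using left[OF elem_in_skew_ring[of _ D, OF y(1)] x(3)] by metis
    moreover have "skew_mult D h (elem (h t x) t 1) (elem x (- t) 1) = elem (h t x) 0 (1 :: 'k)"
      using skew_mult_elem[of "h t x" t "- t" 1 1] x y by simp
    ultimately have "elem (h t x) 0 (1 :: 'k) \<in> I"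
      using right[OF elem_in_skew_ring[of _ D, OF x(1)]] by metis
    then show "h t x \<in> ?V" using in_X[OF y(1)] by blast
  qed auto
  then consider "?V = {}" | "?V = X" using assms(1) unfolding minimal_action_def by blast
  then show "I = {0} \<or> I = skew_ring D"
  proof cases
    case 1
    have "a t x = 0" if a: "a \<in> I" for a t x
    proof (rule ccontr)
      assume nz: "a t x \<noteq> 0"
      have aR: "a \<in> skew_ring D" using a sub by blast
      then have xt: "x \<in> D t" using nz by (auto simp: skew_ring_iff)
      then have xX: "x \<in> D 0" "x \<in> X" using in_X[OF xt] by (auto simp: D_zero)
      let ?y = "h (- t) x"
      have y: "?y \<in> D (- t)" using xt h_minus_in by blast
      let ?b = "skew_mult D h (elem x 0 1) a"
      have b: "?b s z = (if z = x then a s x else 0)" for s z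
        using skew_mult_elem_left[OF xX(1) aR, of 1 s z] xX by (simp add: h_zero)
      have bI: "?b \<in> I" by (rule left[OF elem_in_skew_ring[of _ D, OF xX(1)] a])
      \<comment> \<open>This right factor selects the point \<open>?y\<close>, brings degree
        \<open>t\<close> back to 0 and normalises the coefficient, all at once.\<close>
      let ?e = "elem ?y (- t) (inverse (a t x))"
      have eR: "?e \<in> skew_ring D" using y by (rule elem_in_skew_ring)
      have "skew_mult D h ?b ?e = elem x 0 1"
      proof (intro ext)
        fix r z
        have bR: "?b \<in> skew_ring D" using bI sub by blast
        have fin: "finite {s. ?b s \<noteq> 0}" using bR by (simp add: skew_ring_iff)
        have bt: "?b t \<noteq> 0" using b[of t x] nz by auto
        have "skew_mult D h ?b ?e r z = (\<Sum>s | ?b s \<noteq> 0. ?b s z * ?e (r - s) (h (- s) z))"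
          using bR eR by (intro skew_mult_apply) (auto simp: skew_ring_iff)
        also have "\<dots> = (\<Sum>s | ?b s \<noteq> 0. if t = s then elem x 0 1 r z else 0)"
        proof (rule sum.cong[OF refl])
          fix s
          show "?b s z * ?e (r - s) (h (- s) z) = (if t = s then elem x 0 1 r z else 0)"
          proof (cases "t = s")
            case True
            then show ?thesis using nz by (auto simp: b elem_apply)
          next
            case False
            \<comment> \<open>Freeness enters here: no other degree with a nonzero coefficient at
              \<open>x\<close> leads from \<open>x\<close> to \<open>?y\<close>, so only the term
              \<open>s = t\<close> survives.\<close>
            have "a s x = 0 \<or> h (- s) x \<noteq> ?y"
              using free_actionD[OF free xt, of s] False aR by (auto simp: skew_ring_iff)
            then show ?thesis using False by (auto simp: b elem_apply)
          qed
        qed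
        also have "\<dots> = elem x 0 1 r z" using fin bt by (subst sum.delta') auto
        finally show "skew_mult D h ?b ?e r z = elem x 0 1 r z" .
      qed
      then have "elem x 0 1 \<in> I" using right[OF eR bI] by simp
      then show False using 1 xX by blast
    qed
    then have "a = 0" if "a \<in> I" for a using that by (simp add: fun_eq_iff)
    then show ?thesis using zero by blast
  next
    case 2
    \<comment> \<open>\<open>elem x 0 1\<close> is a left unit for every \<open>elem x t c\<close>,
      so the ideal absorbs all spanning elements even if the ring has no identity.\<close>
    have E: "elem x t c \<in> I" if "x \<in> D t" for x t c
    proof -
      have x: "x \<in> D 0" "x \<in> X" using in_X[OF that] by (auto simp: D_zero)
      have "skew_mult D h (elem x 0 1) (elem x t c) = elem x t c"
        using skew_mult_elem[of x 0 t 1 c] that x by (simp add: h_zero)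
      moreover have "elem x 0 1 \<in> I" using 2 x by blast
      ultimately show ?thesis using right[OF elem_in_skew_ring[of _ D, OF that]] by metis
    qed
    have "a \<in> I" if a: "a \<in> skew_ring D" for a
      by (subst skew_ring_eq_sum_elem[OF a], intro two_sided_ideal_sum[OF I] E)
        (use a in \<open>auto simp: skew_ring_iff\<close>)
    then show ?thesis using sub by blast
  qed
qed

end

theorem theorem3p1:
  fixes X :: "'x set"
    and D :: "'g::ab_group_add \<Rightarrow> 'x set"
    and h :: "'g \<Rightarrow> 'x \<Rightarrow> 'x"
  assumes "partial_action X D h"
  shows "simple_ring (skew_ring D :: ('g \<Rightarrow> 'x \<Rightarrow> 'k::field) set) (skew_mult D h)
    \<longleftrightarrow> minimal_action X D h \<and> free_action D h"
  using partial_action.simple_imp_minimal[OF assms] partial_action.simple_imp_free[OF assms]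
    partial_action.minimal_free_imp_simple[OF assms]
  by blast

end
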